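(* Let $j \geq 3$ be an odd integer, let $m$ be a positive integer, and let $D = \{1, j, mj\}$. If $m$ is odd then $\mu(D) = \kappa(D) = 1/2$; if $m$ is even then $\mu(D) = \kappa(D) = \frac{m}{2(m+1)}$.
   Context: For a set $D$ of positive integers, a $D$-sequence is a set $S$ of nonnegative integers such that $|x-y| \notin D$ for all $x,y \in S$. For $N \geq 0$ write $S[N] = |S \cap \{0,1,\dots,N\}|$. The upper and lower densities of $S$ are $\limsup_{N\to\infty} S[N]/(N+1)$ and $\liminf_{N\to\infty} S[N]/(N+1)$; if they coincide, the common value is the density $\delta(S)$. Define $\mu(D) = \sup\{\delta(S) : S \text{ is a } D\text{-sequence having a density}\}$. For a real $x$, $\|x\|$ denotes the distance from $x$ to the nearest integer, and $\kappa(D) = \sup_{t \in \mathbb{R}} \min_{d \in D} \|td\|$. *)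

theory Defs
  imports Complex_Main "HOL-Library.Extended_Real"
begin

definition D_sequence :: "nat set \<Rightarrow> nat set \<Rightarrow> bool" where
  "D_sequence D S \<longleftrightarrow> (\<forall>x\<in>S. \<forall>y\<in>S. nat \<bar>int x - int y\<bar> \<notin> D)"

definition count_upto :: "nat set \<Rightarrow> nat \<Rightarrow> nat" where
  "count_upto S N = card (S \<inter> {0..N})"

definition upper_density :: "nat set \<Rightarrow> ereal" where
  "upper_density S = limsup (\<lambda>N. ereal (real (count_upto S N) / real (N + 1)))"

definition lower_density :: "nat set \<Rightarrow> ereal" where
  "lower_density S = liminf (\<lambda>N. ereal (real (count_upto S N) / real (N + 1)))"

definition has_seq_density :: "nat set \<Rightarrow> bool" where
  "has_seq_density S \<longleftrightarrow> upper_density S = lower_density S"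

text \<open>The quotients lie in \<open>[0, 1]\<close>, so the conversion to \<^typ>\<open>real\<close> loses nothing.
  The value is meaningful only under \<^const>\<open>has_seq_density\<close>.\<close>
definition seq_density :: "nat set \<Rightarrow> real" where
  "seq_density S = real_of_ereal (upper_density S)"

definition mu :: "nat set \<Rightarrow> real" where
  "mu D = Sup {seq_density S | S. D_sequence D S \<and> has_seq_density S}"

definition dist_nearest_int :: "real \<Rightarrow> real" where
  "dist_nearest_int x = \<bar>x - of_int (round x)\<bar>"

text \<open>Meaningful for finite nonempty \<open>D\<close> only, because of \<^const>\<open>Min\<close>.\<close>
definition kappa :: "nat set \<Rightarrow> real" where
  "kappa D = (SUP t::real. Min ((\<lambda>d. dist_nearest_int (t * real d)) ` D))"

end

theory Submission imports Defs begin

text \<open>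
  For odd \<open>m\<close> all differences are odd: the even numbers are a \<open>D\<close>-sequence, \<open>t = 1/2\<close> is
  optimal, and the difference \<open>1\<close> alone bounds the density by \<open>1/2\<close>.

  Let \<open>m\<close> be even. Modulo \<open>(m+1) j\<close>, the differences \<open>j\<close> and \<open>m j = -j\<close> turn each set
  \<open>{a, a + j, \<dots>, a + m j}\<close> into a cycle of odd length \<open>m + 1\<close>, on which a \<open>D\<close>-sequence has at
  most \<open>m/2\<close> elements; this bounds the density by \<open>m/(2(m+1))\<close>. The bound is attained by the numbers
  whose residue modulo \<open>(m+1) j\<close> is even and less than \<open>m j\<close>. For \<open>\<kappa>\<close>, a number at distance
  \<open>e\<close> from \<open>\<int> + 1/2\<close> is sent by multiplication with \<open>m\<close> to within \<open>m e\<close> of an integer, so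
  \<open>\<kappa> \<le> m (1/2 - \<kappa>)\<close>; equality holds at \<open>t = 1/2 - 1/(2 (m+1) j)\<close>.
\<close>

section \<open>Densities\<close>

lemma D_sequence_iff_add:
  "D_sequence D S \<longleftrightarrow> (\<forall>x\<in>S. \<forall>d\<in>D. x + d \<notin> S)"
proof
  assume "D_sequence D S"
  then show "\<forall>x\<in>S. \<forall>d\<in>D. x + d \<notin> S"
    by (force simp: D_sequence_def)
next
  assume *: "\<forall>x\<in>S. \<forall>d\<in>D. x + d \<notin> S"
  show "D_sequence D S"
    unfolding D_sequence_def
  proof (intro ballI notI)
    fix x y assume xy: "x \<in> S" "y \<in> S" and d: "nat \<bar>int x - int y\<bar> \<in> D"
    have "x + nat \<bar>int x - int y\<bar> = y \<or> y + nat \<bar>int x - int y\<bar> = x" by linarith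
    with * xy d show False by metis
  qed
qed

section \<open>Counting in consecutive blocks of length \<open>q\<close>, and the resulting
  densities\<close>

lemma count_upto_le_blocks:
  assumes q: "q > 0"
    and block: "\<And>n. card (S \<inter> {n * q..<n * q + q}) \<le> c"
  shows "count_upto S N \<le> c * ((N + 1) div q + 1)"
proof -
  have blocks: "card (S \<inter> {..<n * q}) \<le> c * n" for n
  proof (induction n)
    case (Suc n)
    have "S \<inter> {..<Suc n * q} = (S \<inter> {..<n * q}) \<union> (S \<inter> {n * q..<n * q + q})"
      by auto
    then have "card (S \<inter> {..<Suc n * q})
        \<le> card (S \<inter> {..<n * q}) + card (S \<inter> {n * q..<n * q + q})"
      by (simp add: card_Un_le)
    with Suc block[of n] show ?case by simp
  qed simp
  \<comment> \<open>One block beyond the complete ones covers the rest of \<open>{0..N}\<close>; it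
    causes the error term \<open>c / (N + 1)\<close> in the ratio.\<close>
  have "N + 1 < ((N + 1) div q + 1) * q"
    using dividend_less_div_times[OF q, of "N + 1"] by (simp add: algebra_simps)
  then have "S \<inter> {0..N} \<subseteq> S \<inter> {..<((N + 1) div q + 1) * q}" by auto
  then have "count_upto S N \<le> card (S \<inter> {..<((N + 1) div q + 1) * q})"
    unfolding count_upto_def by (intro card_mono) auto
  also have "\<dots> \<le> c * ((N + 1) div q + 1)" by (rule blocks)
  finally show ?thesis .
qed

lemma count_upto_ge_blocks:
  assumes block: "\<And>n. c \<le> card (S \<inter> {n * q..<n * q + q})"
  shows "c * ((N + 1) div q) \<le> count_upto S N"
proof -
  have blocks: "c * n \<le> card (S \<inter> {..<n * q})" for n
  proof (induction n)
    case (Suc n)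
    have "S \<inter> {..<Suc n * q} = (S \<inter> {..<n * q}) \<union> (S \<inter> {n * q..<n * q + q})"
      by auto
    moreover have "(S \<inter> {..<n * q}) \<inter> (S \<inter> {n * q..<n * q + q}) = {}" by auto
    ultimately have "card (S \<inter> {..<Suc n * q})
        = card (S \<inter> {..<n * q}) + card (S \<inter> {n * q..<n * q + q})"
      by (simp add: card_Un_disjoint)
    with Suc block[of n] show ?case by simp
  qed simp
  have "(N + 1) div q * q \<le> N + 1" by (rule div_times_less_eq_dividend)
  then have "x \<le> N" if "x < (N + 1) div q * q" for x
    using that by linarith
  then have "S \<inter> {..<(N + 1) div q * q} \<subseteq> S \<inter> {0..N}" by auto
  then have "card (S \<inter> {..<(N + 1) div q * q}) \<le> count_upto S N"
    unfolding count_upto_def by (intro card_mono) auto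
  with blocks show ?thesis by (rule order_trans)
qed

lemma tendsto_add_const_over_Suc:
  "(\<lambda>N. a + b / real (N + 1)) \<longlonglongrightarrow> a"
proof -
  have "(\<lambda>N. b * inverse (real (Suc N))) \<longlonglongrightarrow> b * 0"
    by (intro tendsto_mult tendsto_const LIMSEQ_inverse_real_of_nat)
  then have "(\<lambda>N. a + b * inverse (real (Suc N))) \<longlonglongrightarrow> a + b * 0"
    by (intro tendsto_add tendsto_const)
  then show ?thesis by (simp add: divide_inverse)
qed

lemma count_upto_ratio_le:
  assumes q: "q > 0"
    and block: "\<And>n. card (S \<inter> {n * q..<n * q + q}) \<le> c"
  shows "real (count_upto S N) / real (N + 1) \<le> real c / real q + real c / real (N + 1)"
proof -
  have "real (count_upto S N) \<le> real c * (real ((N + 1) div q) + 1)"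
    using count_upto_le_blocks[OF assms, of N] by (metis of_nat_1 of_nat_add of_nat_le_iff of_nat_mult)
  also have "\<dots> \<le> real c * (real (N + 1) / real q + 1)"
    by (intro mult_left_mono add_right_mono of_nat_div_le_of_nat) auto
  finally have "real (count_upto S N) / real (N + 1)
      \<le> real c * (real (N + 1) / real q + 1) / real (N + 1)"
    by (rule divide_right_mono) simp
  also have "\<dots> = real c / real q + real c / real (N + 1)"
    using q by (simp add: field_simps)
  finally show ?thesis .
qed

lemma count_upto_ratio_ge:
  assumes q: "q > 0"
    and block: "\<And>n. c \<le> card (S \<inter> {n * q..<n * q + q})"
  shows "real c / real q + (- real c) / real (N + 1) \<le> real (count_upto S N) / real (N + 1)"
proof -
  have "real (N + 1) / real q - 1 \<le> real ((N + 1) div q)"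
  proof -
    have "real ((N + 1) mod q) / real q \<le> 1" using q by (simp add: less_imp_le)
    then show ?thesis
      using of_nat_of_nat_div_aux[of "N + 1" q, where 'a = real] by linarith
  qed
  then have "real c * (real (N + 1) / real q - 1) \<le> real c * real ((N + 1) div q)"
    by (rule mult_left_mono) simp
  also have "\<dots> \<le> real (count_upto S N)"
    using count_upto_ge_blocks[OF block, of N] by (metis of_nat_le_iff of_nat_mult)
  finally have "real c * (real (N + 1) / real q - 1) / real (N + 1)
      \<le> real (count_upto S N) / real (N + 1)"
    by (rule divide_right_mono) simp
  moreover have "real c * (real (N + 1) / real q - 1) / real (N + 1)
      = real c / real q + (- real c) / real (N + 1)"
    using q by (simp add: field_simps)
  ultimately show ?thesis by simp
qed

text \<open>The ratio estimate passes to the limsup, since its error term vanishes.\<close>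

lemma seq_density_le_blocks:
  assumes "q > 0" and "\<And>n. card (S \<inter> {n * q..<n * q + q}) \<le> c"
  shows "seq_density S \<le> real c / real q"
proof -
  let ?r = "\<lambda>N. real (count_upto S N) / real (N + 1)"
  let ?b = "\<lambda>N. real c / real q + real c / real (N + 1)"
  have "(\<lambda>N. ereal (?b N)) \<longlonglongrightarrow> ereal (real c / real q)"
    using tendsto_add_const_over_Suc by (simp only: lim_ereal)
  then have "limsup (\<lambda>N. ereal (?b N)) = ereal (real c / real q)"
    by (intro lim_imp_Limsup) auto
  moreover have "limsup (\<lambda>N. ereal (?r N)) \<le> limsup (\<lambda>N. ereal (?b N))"
    using count_upto_ratio_le[OF assms] by (intro Limsup_mono always_eventually) auto
  ultimately have upper: "upper_density S \<le> ereal (real c / real q)"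
    by (simp add: upper_density_def)
  \<comment> \<open>Together with \<open>upper\<close> this makes the upper density finite, so
    \<open>real_of_ereal\<close> returns its true value and not the default 0.\<close>
  have "0 \<le> upper_density S"
    unfolding upper_density_def by (intro le_Limsup always_eventually) auto
  with upper show ?thesis
    unfolding seq_density_def by (cases "upper_density S") auto
qed

text \<open>Every block of \<open>S\<close> is a translate of \<open>A\<close>, so both block
  estimates hold with \<open>c = card A\<close> and squeeze the ratio.\<close>

lemma density_periodic:
  assumes q: "q > 0" and A: "A \<subseteq> {..<q}"
  defines "S \<equiv> {n. n mod q \<in> A}"
  shows "has_seq_density S" "seq_density S = real (card A) / real q"
proof -
  have block: "card (S \<inter> {n * q..<n * q + q}) = card A" for n
  proof -
    have "S \<inter> {n * q..<n * q + q} = (\<lambda>a. n * q + a) ` A"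
    proof (intro equalityI subsetI)
      fix x assume x: "x \<in> S \<inter> {n * q..<n * q + q}"
      then obtain a where a: "x = n * q + a" "a < q"
        by (auto simp: le_iff_add)
      with x show "x \<in> (\<lambda>a. n * q + a) ` A" by (auto simp: S_def)
    next
      fix x assume "x \<in> (\<lambda>a. n * q + a) ` A"
      with A show "x \<in> S \<inter> {n * q..<n * q + q}" by (auto simp: S_def subset_iff)
    qed
    then show ?thesis by (simp add: card_image)
  qed
  have "(\<lambda>N. real (count_upto S N) / real (N + 1)) \<longlonglongrightarrow> real (card A) / real q"
    using count_upto_ratio_ge[OF q, of "card A" S] count_upto_ratio_le[OF q, of S "card A"] block
    by (intro tendsto_sandwich[OF _ _ tendsto_add_const_over_Suc[where b = "- real (card A)"]
            tendsto_add_const_over_Suc[where b = "real (card A)"]] always_eventually allI)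
      (simp_all del: of_nat_add)
  then have lim: "(\<lambda>N. ereal (real (count_upto S N) / real (N + 1)))
      \<longlonglongrightarrow> ereal (real (card A) / real q)"
    by (simp only: lim_ereal)
  then show "has_seq_density S" "seq_density S = real (card A) / real q"
    unfolding has_seq_density_def seq_density_def upper_density_def lower_density_def
    by (simp_all only: lim_imp_Limsup[OF sequentially_bot lim] lim_imp_Liminf[OF sequentially_bot lim]
          real_of_ereal.simps)
qed

text \<open>The supremum is a maximum: the periodic set attains the value, and a block bound with
  the same period \<open>q\<close> caps every competitor.\<close>

lemma mu_eqI:
  assumes "q > 0" and "A \<subseteq> {..<q}"
    and "D_sequence D {n. n mod q \<in> A}"
    and "\<And>S n. D_sequence D S \<Longrightarrow> card (S \<inter> {n * q..<n * q + q}) \<le> card A"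
  shows "mu D = real (card A) / real q"
  unfolding mu_def
proof (rule cSup_eq_maximum)
  show "real (card A) / real q \<in> {seq_density S |S. D_sequence D S \<and> has_seq_density S}"
    using density_periodic[OF assms(1,2)] assms(3) by force
next
  fix x assume "x \<in> {seq_density S |S. D_sequence D S \<and> has_seq_density S}"
  then show "x \<le> real (card A) / real q"
    using seq_density_le_blocks[OF assms(1) assms(4)] by blast
qed

text \<open>The successor map of the cycle 0, ..., \<open>m\<close> is injective and moves
  \<open>T\<close> off itself, so two disjoint sets of the same size fit into \<open>m + 1\<close>
  points.\<close>

lemma card_cyclically_independent_le:
  fixes T :: "nat set"
  assumes T: "T \<subseteq> {..m}" and succ: "\<And>i. i \<in> T \<Longrightarrow> Suc i \<notin> T"
    and wrap: "0 \<in> T \<Longrightarrow> m \<notin> T"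
  shows "2 * card T \<le> m + 1"
proof -
  define f where "f i = (if i = m then 0 else Suc i)" for i
  have "inj_on f T" by (auto simp: inj_on_def f_def split: if_splits)
  then have "card (f ` T) = card T" by (rule card_image)
  moreover have "T \<inter> f ` T = {}" using succ wrap by (auto simp: f_def)
  moreover have "T \<union> f ` T \<subseteq> {..m}" using T by (auto simp: f_def subset_iff le_less)
  then have "card (T \<union> f ` T) \<le> m + 1" using card_mono[of "{..m}"] by fastforce
  moreover have "finite T" using T finite_subset by blast
  ultimately show ?thesis by (simp add: card_Un_disjoint)
qed

text \<open>The block splits into \<open>j\<close> residue classes modulo \<open>j\<close>, each
  with \<open>2 * k + 1\<close> members. Neighbours in a class differ by \<open>j\<close> and its
  two ends by \<open>2 * k * j\<close>, so the cycle bound applies, and parity rounds it down to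
  \<open>k\<close>.\<close>

lemma card_D_sequence_block_le:
  assumes S: "D_sequence D S" and D: "j \<in> D" "2 * k * j \<in> D" and j: "j > 0"
  shows "card (S \<inter> {x..<x + (2 * k + 1) * j}) \<le> k * j"
proof -
  define T where "T a = {i. i \<le> 2 * k \<and> x + a + i * j \<in> S}" for a
  have T: "card (T a) \<le> k" for a
  proof -
    have "2 * card (T a) \<le> 2 * k + 1"
    proof (rule card_cyclically_independent_le)
      fix i assume "i \<in> T a"
      then have "x + a + i * j + j \<notin> S"
        using S D by (auto simp: T_def D_sequence_iff_add)
      then show "Suc i \<notin> T a" by (simp add: T_def algebra_simps)
    next
      assume "0 \<in> T a"
      then have "x + a + 2 * k * j \<notin> S"
        using S D by (auto simp: T_def D_sequence_iff_add)
      then show "2 * k \<notin> T a" by (simp add: T_def)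
    qed (auto simp: T_def)
    then show ?thesis by simp
  qed
  have fin: "finite (T a)" for a by (simp add: T_def)
  have "S \<inter> {x..<x + (2 * k + 1) * j} \<subseteq> (\<Union>a<j. (\<lambda>i. x + a + i * j) ` T a)"
  proof
    fix y assume y: "y \<in> S \<inter> {x..<x + (2 * k + 1) * j}"
    define a where "a = (y - x) mod j"
    define i where "i = (y - x) div j"
    have y_eq: "y = x + a + i * j" using y by (simp add: a_def i_def)
    have "i < 2 * k + 1"
      unfolding i_def using y j by (intro less_mult_imp_div_less) auto
    then have "i \<in> T a" using y y_eq by (simp add: T_def)
    moreover have "a < j" using j by (simp add: a_def)
    ultimately show "y \<in> (\<Union>a<j. (\<lambda>i. x + a + i * j) ` T a)" using y_eq by blast
  qed
  then have "card (S \<inter> {x..<x + (2 * k + 1) * j}) \<le> card (\<Union>a<j. (\<lambda>i. x + a + i * j) ` T a)"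
    by (intro card_mono) (auto simp: fin)
  also have "\<dots> \<le> (\<Sum>a<j. card ((\<lambda>i. x + a + i * j) ` T a))" by (rule card_UN_le) simp
  also have "\<dots> \<le> (\<Sum>a<j. k)"
    by (intro sum_mono order_trans[OF card_image_le T] fin)
  finally show ?thesis by (simp add: mult.commute)
qed

section \<open>The value of \<open>mu\<close> for odd and for even multiples\<close>

lemma mu_all_odd:
  assumes "1 \<in> D" and odd: "\<And>d. d \<in> D \<Longrightarrow> odd d"
  shows "mu D = 1 / 2"
proof -
  have "mu D = real (card {0::nat}) / real 2"
  proof (rule mu_eqI)
    show "D_sequence D {n. n mod 2 \<in> {0}}"
      using odd by (auto simp: D_sequence_iff_add simp flip: even_iff_mod_2_eq_zero)
  next
    fix S n assume "D_sequence D S"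
    then have "x \<in> S \<Longrightarrow> Suc x \<notin> S" for x
      using assms(1) by (force simp: D_sequence_iff_add)
    moreover have "{n * 2..<n * 2 + 2} = {n * 2, Suc (n * 2)}" by auto
    ultimately have "S \<inter> {n * 2..<n * 2 + 2} \<subseteq> {n * 2} \<or> S \<inter> {n * 2..<n * 2 + 2} \<subseteq> {Suc (n * 2)}"
      by auto
    then show "card (S \<inter> {n * 2..<n * 2 + 2}) \<le> card {0::nat}"
      using card_mono[of "{n * 2}"] card_mono[of "{Suc (n * 2)}"] by fastforce
  qed auto
  then show ?thesis by simp
qed

lemma mu_even_multiple:
  assumes j: "odd j" and k: "k > 0"
  shows "mu {1, j, 2 * k * j} = real k / real (2 * k + 1)"
proof -
  let ?D = "{1, j, 2 * k * j}"
  define q where "q = (2 * k + 1) * j"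
  define A where "A = (\<lambda>u. 2 * u) ` {..<k * j}"
  have j0: "j > 0" using j by (rule odd_pos)
  have card_A: "card A = k * j" by (simp add: A_def card_image inj_on_def)
  have A_iff: "r \<in> A \<longleftrightarrow> even r \<and> r < 2 * k * j" for r
    by (auto simp: A_def elim!: evenE)
  have q_eq: "q = 2 * k * j + j" by (simp add: q_def)
  have jk: "j \<le> k * j" using k by simp
  have "mu ?D = real (card A) / real q"
  proof (rule mu_eqI)
    show "q > 0" using j0 by (simp add: q_def)
    show "A \<subseteq> {..<q}" by (auto simp: A_iff q_eq)
    show "D_sequence ?D {n. n mod q \<in> A}"
      unfolding D_sequence_iff_add
    proof (intro ballI notI)
      fix x d assume x: "x \<in> {n. n mod q \<in> A}" and d: "d \<in> ?D" and xd: "x + d \<in> {n. n mod q \<in> A}"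
      define r where "r = x mod q"
      have r: "even r" "r < 2 * k * j" using x by (auto simp: r_def A_iff)
      have rd: "(r + d) mod q \<in> A" using xd by (simp add: r_def mod_simps)
      show False
      \<comment> \<open>Without wrap-around, an odd \<open>d\<close> changes the parity of
        \<open>r\<close>, and \<open>2 * k * j\<close> leaves the range of \<open>A\<close>. Only
        \<open>d = 2 * k * j\<close> can wrap around; it then acts as subtraction of the odd number
        \<open>j\<close>.\<close>
      proof (cases "r + d < q")
        case True
        then have "even (r + d)" "r + d < 2 * k * j" using rd by (auto simp: A_iff)
        with r d j show False by auto
      next
        case False
        then have d_eq: "d = 2 * k * j" using r d j0 q_eq jk by auto
        then have "(r + d) mod q = r + d - q"
          using False r q_eq by (simp add: le_mod_geq)
        moreover have "r + d - q = r - j" "j \<le> r" using False d_eq q_eq by auto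
        ultimately have "even (r - j)" using rd by (simp add: A_iff)
        with r j \<open>j \<le> r\<close> show False by simp
      qed
    qed
  next
    fix S n assume "D_sequence ?D S"
    then show "card (S \<inter> {n * q..<n * q + q}) \<le> card A"
      unfolding card_A q_def by (rule card_D_sequence_block_le) (use j0 in auto)
  qed
  also have "\<dots> = real k / real (2 * k + 1)" using j0 unfolding card_A q_def of_nat_mult by simp
  finally show ?thesis .
qed

section \<open>Distances to the nearest integer\<close>

lemma dist_nearest_int_le: "dist_nearest_int x \<le> \<bar>x - of_int n\<bar>"
  unfolding dist_nearest_int_def by (rule round_diff_minimal)

lemma dist_nearest_int_le_half: "dist_nearest_int x \<le> 1 / 2"
  unfolding dist_nearest_int_def using of_int_round_abs_le[of x] by (simp add: abs_minus_commute)

lemma dist_nearest_int_ge: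
  assumes "\<bar>x - (of_int n + 1 / 2)\<bar> \<le> e"
  shows "1 / 2 - e \<le> dist_nearest_int x"
proof -
  have "round x \<le> n \<or> n + 1 \<le> round x" by linarith
  then have "real_of_int (round x) \<le> of_int n \<or> of_int n + 1 \<le> real_of_int (round x)"
    by (metis of_int_1 of_int_add of_int_le_iff)
  with assms show ?thesis unfolding dist_nearest_int_def by linarith
qed

text \<open>The even multiplier \<open>2 * k\<close> sends the half-integer \<open>n + 1/2\<close>
  to the integer \<open>2 * k * n + k\<close> and scales the distance to it by
  \<open>2 * k\<close>.\<close>

lemma dist_nearest_int_double_mult_le:
  fixes s :: real
  shows "dist_nearest_int (2 * real k * s) \<le> 2 * real k * (1 / 2 - dist_nearest_int s)"
proof -
  let ?n = "\<lfloor>s\<rfloor>"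
  have "dist_nearest_int s \<le> \<bar>s - of_int ?n\<bar>" "dist_nearest_int s \<le> \<bar>s - of_int (?n + 1)\<bar>"
    by (rule dist_nearest_int_le)+
  \<comment> \<open>Both ends of the unit interval around \<open>s\<close> are at least
    \<open>dist_nearest_int s\<close> away, which confines \<open>s\<close> to the middle.\<close>
  then have "\<bar>s - of_int ?n - 1 / 2\<bar> \<le> 1 / 2 - dist_nearest_int s"
    unfolding of_int_add of_int_1 by linarith
  then have "2 * real k * \<bar>s - of_int ?n - 1 / 2\<bar> \<le> 2 * real k * (1 / 2 - dist_nearest_int s)"
    by (rule mult_left_mono) simp
  moreover have "2 * real k * \<bar>s - of_int ?n - 1 / 2\<bar>
      = \<bar>2 * real k * s - of_int (2 * int k * ?n + int k)\<bar>"
  proof -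
    have "2 * real k * \<bar>s - of_int ?n - 1 / 2\<bar> = \<bar>2 * real k * (s - of_int ?n - 1 / 2)\<bar>"
      by (simp add: abs_mult)
    also have "2 * real k * (s - of_int ?n - 1 / 2) = 2 * real k * s - of_int (2 * int k * ?n + int k)"
      by (simp add: algebra_simps)
    finally show ?thesis .
  qed
  ultimately show ?thesis using dist_nearest_int_le order_trans by metis
qed

text \<open>Quantifying over common lower bounds \<open>w\<close> keeps \<open>Min\<close> out of
  the applications; here \<open>w\<close> becomes the minimum itself.\<close>

lemma kappa_eqI:
  assumes D: "finite D" "D \<noteq> {}"
    and attained: "\<And>d. d \<in> D \<Longrightarrow> v \<le> dist_nearest_int (t * real d)"
    and bound: "\<And>t w. (\<And>d. d \<in> D \<Longrightarrow> w \<le> dist_nearest_int (t * real d)) \<Longrightarrow> w \<le> v"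
  shows "kappa D = v"
proof -
  let ?M = "\<lambda>t. Min ((\<lambda>d. dist_nearest_int (t * real d)) ` D)"
  have le: "?M t \<le> v" for t
    using D by (intro bound[of _ t]) simp
  moreover have "v \<le> ?M t" using D attained by simp
  ultimately have "v = ?M t" by (simp add: order_antisym)
  then show ?thesis
    unfolding kappa_def using le by (intro cSup_eq_maximum) auto
qed

section \<open>The value of \<open>kappa\<close> for odd and for even multiples\<close>

lemma kappa_all_odd:
  assumes D: "finite D" "D \<noteq> {}" and odd: "\<And>d. d \<in> D \<Longrightarrow> odd d"
  shows "kappa D = 1 / 2"
proof (rule kappa_eqI[OF D])
  fix d assume "d \<in> D"
  then obtain a where "d = 2 * a + 1" using odd by (blast elim: oddE)
  then show "1 / 2 \<le> dist_nearest_int (1 / 2 * real d)"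
    using dist_nearest_int_ge[of "1 / 2 * real d" "int a" 0] by (simp add: field_simps)
next
  fix t w :: real
  assume "\<And>d. d \<in> D \<Longrightarrow> w \<le> dist_nearest_int (t * real d)"
  then show "w \<le> 1 / 2" using D dist_nearest_int_le_half order_trans by blast
qed

lemma kappa_even_multiple:
  assumes j: "odd j"
  shows "kappa {1, j, 2 * k * j} = real k / real (2 * k + 1)"
proof -
  \<comment> \<open>The solution of \<open>2 * k * e = 1/2 - e\<close>, where the two constraints
    from \<open>j\<close> and \<open>2 * k * j\<close> balance.\<close>
  define e where "e = 1 / (2 * real (2 * k + 1))"
  have j0: "j > 0" using j by (rule odd_pos)
  have e0: "e \<ge> 0" by (simp add: e_def)
  have bound_eq: "real k / real (2 * k + 1) = 1 / 2 - e" by (simp add: e_def field_simps)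
  have ke: "2 * real k * e = 1 / 2 - e" by (simp add: e_def field_simps)
  obtain a where a: "j = 2 * a + 1" using j by (rule oddE)
  show ?thesis
    unfolding bound_eq
  \<comment> \<open>This \<open>t\<close> puts \<open>t * j\<close> exactly \<open>e\<close> below a
    half-integer, and \<open>t\<close> itself at most \<open>e\<close> below
    \<open>1/2\<close>.\<close>
  proof (rule kappa_eqI[where t = "1 / 2 - e / real j"])
    fix d assume "d \<in> {1, j, 2 * k * j}"
    then consider "d = 1" | "d = j" | "d = 2 * k * j" by blast
    then show "1 / 2 - e \<le> dist_nearest_int ((1 / 2 - e / real j) * real d)"
    proof cases
      case 1
      have "e / real j \<le> e / 1" using e0 j0 by (intro divide_left_mono) auto
      then show ?thesis
        using dist_nearest_int_ge[of "1 / 2 - e / real j" 0 e] e0 1 by simp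
    next
      case 2
      have "(1 / 2 - e / real j) * real d = real_of_int (int a) + 1 / 2 - e"
        using j0 2 a by (simp add: field_simps)
      then show ?thesis
        using dist_nearest_int_ge[of _ "int a" e] e0 by simp
    next
      case 3
      have "(1 / 2 - e / real j) * real d = real k * real j - 2 * real k * e"
        using j0 3 by (simp add: field_simps)
      \<comment> \<open>The product lies \<open>1/2 - e\<close> below the integer
        \<open>k * j\<close>, hence \<open>e\<close> above the half-integer preceding it.\<close>
      also have "\<dots> = real_of_int (int (k * j) - 1) + 1 / 2 + e"
        unfolding ke by simp
      finally show ?thesis
        using dist_nearest_int_ge[of _ "int (k * j) - 1" e] e0 by simp
    qed
  next
    fix t w :: real
    assume w: "\<And>d. d \<in> {1, j, 2 * k * j} \<Longrightarrow> w \<le> dist_nearest_int (t * real d)"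
    \<comment> \<open>With \<open>s = t * j\<close> the scaling lemma gives
      \<open>w \<le> 2 * k * (1/2 - w)\<close>, which is then solved for \<open>w\<close>.\<close>
    have "w \<le> dist_nearest_int (t * real (2 * k * j))" by (rule w) simp
    also have "t * real (2 * k * j) = 2 * real k * (t * real j)" by simp
    also have "dist_nearest_int \<dots> \<le> 2 * real k * (1 / 2 - dist_nearest_int (t * real j))"
      by (rule dist_nearest_int_double_mult_le)
    also have "\<dots> \<le> 2 * real k * (1 / 2 - w)"
      using w[of j] by (intro mult_left_mono) auto
    finally have "w * real (2 * k + 1) \<le> real k" by (simp add: algebra_simps)
    then have "w \<le> real k / real (2 * k + 1)" by (subst pos_le_divide_eq) auto
    then show "w \<le> 1 / 2 - e" unfolding bound_eq .
  qed auto
qed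

theorem theorem4:
  fixes j m :: nat and D :: "nat set"
  assumes "j \<ge> 3" and "odd j" and "m > 0"
    and "D = {1, j, m * j}"
  shows "(odd m \<longrightarrow> mu D = 1 / 2 \<and> kappa D = 1 / 2) \<and>
         (even m \<longrightarrow> mu D = real m / (2 * (real m + 1)) \<and>
                    kappa D = real m / (2 * (real m + 1)))"
proof (intro conjI impI)
  assume "odd m"
  then have odd: "odd d" if "d \<in> D" for d
    using that assms by auto
  show "mu D = 1 / 2" by (rule mu_all_odd[OF _ odd]) (simp_all add: assms(4))
  show "kappa D = 1 / 2" by (rule kappa_all_odd[OF _ _ odd]) (simp_all add: assms(4))
next
  assume "even m"
  then obtain k where k: "m = 2 * k" by (rule evenE)
  then have "k > 0" using assms(3) by simp
  have "real m / (2 * (real m + 1)) = real k / real (2 * k + 1)"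
    by (simp add: k field_simps)
  then show "mu D = real m / (2 * (real m + 1))" "kappa D = real m / (2 * (real m + 1))"
    using mu_even_multiple[OF assms(2) \<open>k > 0\<close>] kappa_even_multiple[OF assms(2), of k] assms(4) k
    by simp_all
qed

end
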